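(* For every positive integer $n$, the graph $D_n(P_n)$ is connected.
   Context: $P_n$ is the path with vertex set $\{1,2,\dots,n\}$ and edge set $\{\{1,2\},\{2,3\},\dots,\{n-1,n\}\}$. A set $S\subseteq V(G)$ is a dominating set of a graph $G$ if every vertex of $V(G)\setminus S$ is adjacent to at least one vertex of $S$. The graph $D_n(P_n)$ has as vertices all dominating sets of $P_n$, two of them being adjacent if and only if one is obtained from the other by adding or deleting a single vertex (i.e. their symmetric difference has exactly one element). *)

theory Defs
  imports "Graph_Theory.Graph_Theory"
begin

text \<open>
  An undirected simple graph is represented by a loop-free symmetric digraph, each edge
  \<open>{u, v}\<close> being the two arcs \<open>(u, v)\<close> and \<open>(v, u)\<close>; this is the locale \<^locale>\<open>pair_graph\<close>
  (which also requires finiteness).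
\<close>

definition path_graph :: "nat \<Rightarrow> nat pair_pre_digraph" where
  "path_graph n =
     \<lparr> pverts = {1..n},
       parcs = {(i, i + 1) | i. 1 \<le> i \<and> i < n} \<union> {(i + 1, i) | i. 1 \<le> i \<and> i < n} \<rparr>"

definition dominating_set :: "'a pair_pre_digraph \<Rightarrow> 'a set \<Rightarrow> bool" where
  "dominating_set G S \<longleftrightarrow>
     S \<subseteq> pverts G \<and> (\<forall>v \<in> pverts G - S. \<exists>u \<in> S. (v, u) \<in> parcs G)"

definition dominating_graph :: "'a pair_pre_digraph \<Rightarrow> 'a set pair_pre_digraph" where
  "dominating_graph G =
     \<lparr> pverts = {S. dominating_set G S},
       parcs = {(S, T). dominating_set G S \<and> dominating_set G T \<and> card (sym_diff S T) = 1} \<rparr>"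

lemma pair_graph_path_graph: "pair_graph (path_graph n)"
proof
  have "parcs (path_graph n) \<subseteq> {1..n} \<times> {1..n}"
    by (auto simp: path_graph_def)
  then show "finite (parcs (path_graph n))"
    by (rule finite_subset) simp
qed (auto simp: path_graph_def symmetric_def sym_def)

lemma pair_graph_dominating_graph:
  assumes "finite (pverts G)"
  shows "pair_graph (dominating_graph G)"
proof
  have fin: "finite {S. dominating_set G S}"
    by (rule finite_subset[of _ "Pow (pverts G)"]) (use assms in \<open>auto simp: dominating_set_def\<close>)
  then show "finite (pverts (dominating_graph G))"
    by (simp add: dominating_graph_def)
  have "parcs (dominating_graph G) \<subseteq> {S. dominating_set G S} \<times> {S. dominating_set G S}"
    by (auto simp: dominating_graph_def)
  then show "finite (parcs (dominating_graph G))"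
    by (rule finite_subset) (use fin in simp)
qed (auto simp: dominating_graph_def symmetric_def sym_def Un_commute)

end

theory Submission
  imports Defs
begin

text \<open>
  Every superset of a dominating set is dominating, so a dominating set can be enlarged one vertex
  at a time, through dominating sets only, until it is the whole vertex set
  (\<open>dominating_graph_reachable_superset\<close>). The whole vertex set is therefore a hub of the
  dominating graph: adjacency being symmetric, any two dominating sets are joined by a walk through
  it. This holds for every finite graph (\<open>connected_dominating_graph\<close>), in particular for paths.
\<close>

lemma dominating_set_superset:
  assumes "dominating_set G S" "S \<subseteq> T" "T \<subseteq> pverts G"
  shows "dominating_set G T"
  using assms unfolding dominating_set_def by blast

lemma dominating_graph_insert:
  assumes "dominating_set G S" "v \<in> pverts G - S"
  shows "(S, insert v S) \<in> parcs (dominating_graph G)"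
proof -
  have "insert v S \<subseteq> pverts G"
    using assms by (auto simp: dominating_set_def)
  then have "dominating_set G (insert v S)"
    using dominating_set_superset[OF assms(1), of "insert v S"] by blast
  moreover have "sym_diff S (insert v S) = {v}"
    using assms(2) by auto
  ultimately show ?thesis
    using assms(1) by (simp add: dominating_graph_def)
qed

text \<open>
  The walk adds the elements of \<open>T - S\<close> one by one, hence the induction on a finite subset \<open>A\<close> of the
  vertices outside \<open>S\<close>, with \<open>A \<union> S\<close> as the current end of the walk.
\<close>

lemma dominating_graph_reachable_superset:
  assumes fin: "finite (pverts G)"
    and dom: "dominating_set G S" and "S \<subseteq> T" and "T \<subseteq> pverts G"
  shows "S \<rightarrow>\<^sup>*\<^bsub>with_proj (dominating_graph G)\<^esub> T"
proof -
  interpret D: pair_graph "dominating_graph G"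
    using fin by (rule pair_graph_dominating_graph)
  have "finite (T - S)"
    using fin \<open>T \<subseteq> pverts G\<close> by (blast intro: finite_subset)
  moreover have "T - S \<subseteq> pverts G - S"
    using \<open>T \<subseteq> pverts G\<close> by blast
  ultimately have "S \<rightarrow>\<^sup>*\<^bsub>with_proj (dominating_graph G)\<^esub> ((T - S) \<union> S)"
  proof (induction rule: finite_subset_induct)
    case empty
    have "S \<in> pverts (dominating_graph G)"
      using dom by (simp add: dominating_graph_def)
    then show ?case
      by simp
  next
    case (insert v A)
    have "A \<union> S \<in> pverts (dominating_graph G)"
      using D.reachable_in_verts(2)[OF insert.IH] by simp
    then have "dominating_set G (A \<union> S)"
      by (simp add: dominating_graph_def)
    then have "(A \<union> S, insert v (A \<union> S)) \<in> parcs (dominating_graph G)"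
      using insert.hyps by (intro dominating_graph_insert) auto
    then show ?case
      using D.reachable_adj_trans[OF insert.IH] by simp
  qed
  then show ?thesis
    using \<open>S \<subseteq> T\<close> by (simp add: Un_absorb2)
qed

lemma connected_dominating_graph:
  assumes fin: "finite (pverts G)"
  shows "Digraph_Component.connected (with_proj (dominating_graph G))"
proof -
  let ?D = "with_proj (dominating_graph G)"
  interpret D: pair_graph "dominating_graph G"
    using fin by (rule pair_graph_dominating_graph)
  have to_all: "S \<rightarrow>\<^sup>*\<^bsub>?D\<^esub> pverts G" if "S \<in> pverts (dominating_graph G)" for S
    using that fin
    by (intro dominating_graph_reachable_superset)
       (auto simp: dominating_graph_def dominating_set_def)
  have "S \<rightarrow>\<^sup>*\<^bsub>?D\<^esub> T"
    if "S \<in> pverts (dominating_graph G)" "T \<in> pverts (dominating_graph G)" for S T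
    using to_all[OF that(1)] D.symmetric_reachable'[OF to_all[OF that(2)]]
    by (rule D.reachable_trans)
  moreover have "pverts G \<in> pverts (dominating_graph G)"
    by (simp add: dominating_graph_def dominating_set_def)
  ultimately show ?thesis
    unfolding Digraph_Component.connected_def strongly_connected_def
    by (auto intro!: D.reachable_mk_symmetricI)
qed

theorem theorem10:
  fixes n :: nat
  assumes "n \<ge> 1"
  shows "Digraph_Component.connected (with_proj (dominating_graph (path_graph n)))"
  by (rule connected_dominating_graph) (simp add: path_graph_def)

end
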